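(* If an arrangement $\mathcal{A}$ of linear hyperplanes in $\mathbb{R}^d$ is inscribable, then $\mathcal{A}$ is simplicial. Equivalently, every inscribed belt polytope is simple.
   Context: An arrangement is a finite collection of distinct linear hyperplanes in $\mathbb{R}^d$. Its regions (closures of the connected components of the complement of the union of the hyperplanes) and their faces form a complete fan. The normal fan of a polytope $P$ is the collection of normal cones $\{c:\langle c,x\rangle=\max_{y\in P}\langle c,y\rangle\ \forall x\in F\}$ of nonempty faces $F$. A belt polytope is a polytope whose normal fan is the fan of a hyperplane arrangement. A polytope is inscribed if its vertices lie on a common sphere. $\mathcal{A}$ is inscribable if there is an inscribed polytope whose normal fan is the fan of $\mathcal{A}$. $\mathcal{A}$ is simplicial if every region is a simplicial cone, i.e. generated by linearly independent vectors; if $\mathcal{A}$ is not essential (the intersection $\operatorname{lineal}(\mathcal{A})$ of all hyperplanes is not $\{0\}$), this is understood for the essentialization $\{H\cap\operatorname{lineal}(\mathcal{A})^\perp:H\in\mathcal{A}\}$ in $\operatorname{lineal}(\mathcal{A})^\perp$. A polytope of dimension $k$ is simple if every vertex is incident to exactly $k$ edges. *)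

theory Defs
  imports "HOL-Analysis.Analysis"
begin

section \<open>Hyperplane arrangements and their fans\<close>

definition hyperplane_arrangement :: "'a::euclidean_space set set \<Rightarrow> bool" where
  "hyperplane_arrangement \<A> \<longleftrightarrow>
     finite \<A> \<and> (\<forall>H\<in>\<A>. \<exists>a. a \<noteq> 0 \<and> H = {x. a \<bullet> x = 0})"

text \<open>The first argument is the ambient linear subspace; it is \<open>UNIV\<close> except when passing to
  the essentialization.\<close>

definition regions :: "'a::euclidean_space set \<Rightarrow> 'a set set \<Rightarrow> 'a set set" where
  "regions V \<A> = closure ` components (V - \<Union>\<A>)"

text \<open>The library relation \<open>face_of\<close> admits the empty face, which is not a cone of a fan.\<close>

definition arrangement_fan :: "'a::euclidean_space set set \<Rightarrow> 'a set set" where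
  "arrangement_fan \<A> = {F. F \<noteq> {} \<and> (\<exists>R \<in> regions UNIV \<A>. F face_of R)}"

definition lineal :: "'a::euclidean_space set set \<Rightarrow> 'a set" where
  "lineal \<A> = \<Inter>\<A>"

definition essentialization :: "'a::euclidean_space set set \<Rightarrow> 'a set set" where
  "essentialization \<A> = (\<lambda>H. H \<inter> (lineal \<A>)\<^sup>\<bottom>) ` \<A>"

definition simplicial_cone :: "'a::euclidean_space set \<Rightarrow> bool" where
  "simplicial_cone C \<longleftrightarrow> (\<exists>B. independent B \<and> C = convex_cone hull B)"

text \<open>If \<open>\<A>\<close> is essential, then \<open>(lineal \<A>)\<^sup>\<bottom> = UNIV\<close> and \<open>essentialization \<A> = \<A>\<close>,
  so no case distinction is needed.\<close>

definition simplicial_arrangement :: "'a::euclidean_space set set \<Rightarrow> bool" where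
  "simplicial_arrangement \<A> \<longleftrightarrow>
     (\<forall>R \<in> regions ((lineal \<A>)\<^sup>\<bottom>) (essentialization \<A>). simplicial_cone R)"


section \<open>Polytopes\<close>

text \<open>For \<open>F \<subseteq> P\<close> the condition says that \<open>\<lambda>y. c \<bullet> y\<close> attains its maximum over \<open>P\<close> at every
  point of \<open>F\<close>.\<close>

definition normal_cone :: "'a::euclidean_space set \<Rightarrow> 'a set \<Rightarrow> 'a set" where
  "normal_cone P F = {c. \<forall>x\<in>F. \<forall>y\<in>P. c \<bullet> y \<le> c \<bullet> x}"

definition normal_fan :: "'a::euclidean_space set \<Rightarrow> 'a set set" where
  "normal_fan P = {normal_cone P F |F. F face_of P \<and> F \<noteq> {}}"

definition belt_polytope :: "'a::euclidean_space set \<Rightarrow> bool" where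
  "belt_polytope P \<longleftrightarrow>
     polytope P \<and> (\<exists>\<A>. hyperplane_arrangement \<A> \<and> normal_fan P = arrangement_fan \<A>)"

definition inscribed :: "'a::euclidean_space set \<Rightarrow> bool" where
  "inscribed P \<longleftrightarrow> polytope P \<and> (\<exists>z r. \<forall>v. v extreme_point_of P \<longrightarrow> v \<in> sphere z r)"

definition simple_polytope :: "'a::euclidean_space set \<Rightarrow> bool" where
  "simple_polytope P \<longleftrightarrow>
     polytope P \<and>
     (\<forall>v. v extreme_point_of P \<longrightarrow> int (card {e. e edge_of P \<and> v \<in> e}) = aff_dim P)"

definition inscribable :: "'a::euclidean_space set set \<Rightarrow> bool" where
  "inscribable \<A> \<longleftrightarrow> (\<exists>P. inscribed P \<and> normal_fan P = arrangement_fan \<A>)"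

end

theory Submission
  imports Defs
begin

text \<open>Move the centre of the sphere to the origin. Crossing a hyperplane \<open>H\<close> leads from a vertex of
  \<open>P\<close> to a vertex on the same sphere that differs from it by a multiple of the normal of \<open>H\<close>, hence to
  its mirror image in \<open>H\<close>. This makes the orthogonal projection onto a wall of a chamber map the
  chamber into itself, so the inward normals of the walls have pairwise nonpositive inner products.
  Being positive on an interior point, they are then linearly independent, and the chamber is
  simplicial. The edges at the corresponding vertex are in bijection with the walls.\<close>

section \<open>Linear algebra\<close>

text \<open>Crossing a wall relates neighbouring chambers only, whereas obtuseness compares two
  walls of one chamber. The bridge is local: all chambers containing a point y have their vertices
  in the face of P on which y is maximal, and there heights along the normal of a wall K through y
  can be compared. Reflection negates the height over the centre z. Applied to the highest and to
  the lowest vertex, it turns the inequality between the top and the mirror image of the bottom into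
  one between the mirror image of the top and the bottom. As the bottom is a unique minimum, the
  last two vertices coincide, so no second hyperplane through y can separate their chambers.
  Obtuseness then takes a single projection, that of a relatively interior point of one wall onto
  the other.\<close>

lemma positive_perturbation:
  fixes f g :: "'b \<Rightarrow> real"
  assumes "finite A" "\<And>i. i \<in> A \<Longrightarrow> 0 < f i"
  obtains e where "0 < e" "\<And>i t. i \<in> A \<Longrightarrow> \<bar>t\<bar> \<le> e \<Longrightarrow> 0 < f i + t * g i"
proof -
  have "\<exists>e>0. \<forall>i\<in>A. \<forall>t. \<bar>t\<bar> \<le> e \<longrightarrow> 0 < f i + t * g i"
    using assms
  proof (induction A rule: finite_induct)
    case empty
    show ?case by (auto intro: exI[of _ 1])
  next
    case (insert j A)
    then obtain e where e: "e > 0" "\<forall>i\<in>A. \<forall>t. \<bar>t\<bar> \<le> e \<longrightarrow> 0 < f i + t * g i" by auto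
    \<comment> \<open>The summand 1 covers \<open>g j = 0\<close> and makes the estimate below
      strict.\<close>
    define d where "d = f j / (\<bar>g j\<bar> + 1)"
    have d: "d > 0" using insert.prems[of j] by (simp add: d_def add_nonneg_pos)
    have "0 < f j + t * g j" if "\<bar>t\<bar> \<le> d" for t
    proof -
      have "\<bar>t * g j\<bar> \<le> d * \<bar>g j\<bar>" using that by (simp add: abs_mult mult_right_mono)
      also have "\<dots> < d * (\<bar>g j\<bar> + 1)" using d by simp
      also have "\<dots> = f j" by (simp add: d_def)
      finally show ?thesis by linarith
    qed
    then show ?case using e d by (intro exI[of _ "min e d"]) auto
  qed
  then show ?thesis using that by blast
qed

text \<open>The ratio test: along the segment from \<open>f\<close> to \<open>g\<close>, a
  constraint that ends negative is hit at parameter \<open>r i\<close>, and the smallest such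
  parameter is the moment of exit.\<close>

lemma first_exit:
  fixes f g :: "'b \<Rightarrow> real"
  assumes "finite A" "\<And>i. i \<in> A \<Longrightarrow> 0 < f i" "k \<in> A" "g k < 0"
  obtains t m where "0 < t" "t < 1" "\<And>i. i \<in> A \<Longrightarrow> 0 \<le> (1 - t) * f i + t * g i"
    "m \<in> A" "(1 - t) * f m + t * g m = 0"
proof -
  define N where "N = {i\<in>A. g i < 0}"
  define r where "r i = f i / (f i - g i)" for i
  have N: "finite N" "N \<noteq> {}" using assms by (auto simp: N_def)
  then have "Min (r ` N) \<in> r ` N" by (intro Min_in) auto
  then obtain m where m: "m \<in> N" "r m = Min (r ` N)" by auto
  have mA: "m \<in> A" "g m < 0" "0 < f m" using m assms(2) by (auto simp: N_def)
  have eq: "(1 - r m) * f m + r m * g m = 0"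
    using mA by (simp add: r_def field_simps)
  have "0 \<le> (1 - r m) * f i + r m * g i" if i: "i \<in> A" for i
  proof (cases "g i < 0")
    case True
    then have "r m \<le> r i" using i m N by (auto simp: N_def)
    moreover have fi: "0 < f i" using assms(2) i by simp
    ultimately have "r m * (f i - g i) \<le> f i"
      using True by (simp add: r_def pos_le_divide_eq)
    then show ?thesis by (simp add: algebra_simps)
  next
    case False
    have "r m < 1" "0 < r m" using mA by (auto simp: r_def field_simps)
    then show ?thesis using False assms(2)[OF i] by (intro add_nonneg_nonneg mult_nonneg_nonneg) auto
  qed
  moreover have "0 < r m" "r m < 1" using mA by (auto simp: r_def field_simps)
  ultimately show ?thesis using that mA eq by blast
qed

lemma multiple_of_normal:
  fixes a d :: "'a::real_inner"
  assumes "\<And>h. a \<bullet> h = 0 \<Longrightarrow> d \<bullet> h = 0"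
  obtains l where "d = l *\<^sub>R a"
proof (cases "a = 0")
  case True
  then show ?thesis using assms[of d] that[of 0] by simp
next
  case False
  define h where "h = d - ((a \<bullet> d) / (a \<bullet> a)) *\<^sub>R a"
  have "a \<bullet> h = 0" using False by (simp add: h_def inner_diff_right)
  moreover from this have "d \<bullet> h = 0" using assms by simp
  ultimately have "h \<bullet> h = 0"
    by (simp add: h_def inner_diff_left)
  then show ?thesis using that[of "(a \<bullet> d) / (a \<bullet> a)"] by (simp add: h_def)
qed

text \<open>Split a vanishing combination into its positive part \<open>x\<close> and its negative
  part \<open>y\<close>. Then \<open>x = y\<close>, while the two supports are disjoint, so
  obtuseness gives \<open>x \<bullet> x = x \<bullet> y \<le> 0\<close>. Both parts are zero, and
  pairing a nonnegative vanishing combination with \<open>w\<close> kills each coefficient.\<close>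

lemma independent_if_obtuse:
  fixes S :: "'a::real_inner set"
  assumes "finite S" and obtuse: "\<And>s t. s \<in> S \<Longrightarrow> t \<in> S \<Longrightarrow> s \<noteq> t \<Longrightarrow> s \<bullet> t \<le> 0"
    and w: "\<And>s. s \<in> S \<Longrightarrow> 0 < s \<bullet> w"
  shows "independent S"
proof -
  have "\<forall>s\<in>S. f s = 0" if "(\<Sum>s\<in>S. f s *\<^sub>R s) = 0" for f
  proof -
    define x where "x = (\<Sum>s\<in>S. max (f s) 0 *\<^sub>R s)"
    define y where "y = (\<Sum>s\<in>S. max (- f s) 0 *\<^sub>R s)"
    have "x - y = (\<Sum>s\<in>S. f s *\<^sub>R s)"
      unfolding x_def y_def sum_subtractf[symmetric] scaleR_left_diff_distrib[symmetric]
      by (rule sum.cong) (auto simp: max_def)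
    then have "x = y" using that by simp
    then have "x \<bullet> x = x \<bullet> y" by simp
    also have "\<dots> = (\<Sum>s\<in>S. \<Sum>t\<in>S. max (f s) 0 * (max (- f t) 0 * (s \<bullet> t)))"
      by (simp add: x_def y_def inner_sum_left inner_sum_right sum_distrib_left)
        (subst sum.swap, simp add: mult.left_commute)
    also have "\<dots> \<le> 0"
    proof (intro sum_nonpos)
      fix s t assume "s \<in> S" "t \<in> S"
      then show "max (f s) 0 * (max (- f t) 0 * (s \<bullet> t)) \<le> 0"
        using obtuse[of s t] by (cases "s = t") (auto simp: max_def mult_nonneg_nonpos)
    qed
    finally have x0: "x = 0" by (metis inner_eq_zero_iff inner_ge_zero order_antisym)
    have *: "g s = 0" if "s \<in> S" "(\<Sum>s\<in>S. g s *\<^sub>R s) = 0" "\<And>s. 0 \<le> g s" for g s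
    proof -
      have "(\<Sum>s\<in>S. g s * (s \<bullet> w)) = 0"
        using arg_cong[OF that(2), of "\<lambda>x. x \<bullet> w"] by (simp add: inner_sum_left)
      then have "g s * (s \<bullet> w) = 0"
        using that w \<open>finite S\<close> by (subst (asm) sum_nonneg_eq_0_iff) (auto simp: less_imp_le)
      then show ?thesis using w[OF that(1)] by simp
    qed
    have "max (f s) 0 = 0" "max (- f s) 0 = 0" if "s \<in> S" for s
      using *[OF that, of "\<lambda>s. max (f s) 0"] *[OF that, of "\<lambda>s. max (- f s) 0"] x0 \<open>x = y\<close>
      by (simp_all add: x_def y_def)
    then show ?thesis by (force simp: max_def split: if_splits)
  qed
  then show ?thesis using \<open>finite S\<close> by (auto simp: dependent_finite)
qed

text \<open>The dual vector of \<open>s\<close> is the component of \<open>s\<close> orthogonal to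
  the other elements, rescaled. Keeping it inside \<open>span S\<close> is what later serves
  non-essential arrangements.\<close>

lemma dual_basis:
  fixes S :: "'a::euclidean_space set"
  assumes "independent S"
  obtains b where "\<And>s. s \<in> S \<Longrightarrow> b s \<in> span S"
    "\<And>s t. s \<in> S \<Longrightarrow> t \<in> S \<Longrightarrow> t \<bullet> b s = (if s = t then 1 else 0)"
proof -
  have "\<exists>n\<in>span S. \<forall>t\<in>S. t \<bullet> n = (if s = t then 1 else 0)" if s: "s \<in> S" for s
  proof -
    obtain y n where yn: "y \<in> span (S - {s})" "\<And>w. w \<in> span (S - {s}) \<Longrightarrow> orthogonal n w"
      "s = y + n"
      using orthogonal_subspace_decomp_exists[of "S - {s}" s] by blast
    have "n \<noteq> 0" using yn s \<open>independent S\<close> by (auto simp: dependent_def)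
    have "y \<in> span S" using yn(1) span_mono[of "S - {s}" S] by blast
    moreover have "n = s - y" using yn(3) by simp
    ultimately have "n \<in> span S" using s by (simp add: span_diff span_base)
    have "n \<bullet> y = 0" using yn by (simp add: orthogonal_def)
    then have "s \<bullet> n = n \<bullet> n" using yn(3) by (simp add: inner_add_left inner_add_right inner_commute)
    moreover have "t \<bullet> n = 0" if "t \<in> S" "t \<noteq> s" for t
      using yn(2)[of t] that by (simp add: orthogonal_def span_base inner_commute)
    ultimately show ?thesis
      using \<open>n \<noteq> 0\<close> \<open>n \<in> span S\<close>
      by (intro bexI[of _ "n /\<^sub>R (n \<bullet> n)"]) (auto simp: span_scale)
  qed
  then show ?thesis using that by metis
qed

text \<open>The dual basis generates the cone: \<open>x\<close> and the sum of all
  \<open>(s \<bullet> x) *\<^sub>R b s\<close> differ by a vector of \<open>span S\<close> that is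
  orthogonal to \<open>S\<close>.\<close>

lemma simplicial_cone_of_independent_normals:
  fixes S :: "'a::euclidean_space set"
  assumes "independent S"
  shows "simplicial_cone {x \<in> span S. \<forall>s\<in>S. 0 \<le> s \<bullet> x}"
proof -
  obtain b where b: "\<And>s. s \<in> S \<Longrightarrow> b s \<in> span S"
    "\<And>s t. s \<in> S \<Longrightarrow> t \<in> S \<Longrightarrow> t \<bullet> b s = (if s = t then 1 else 0)"
    using dual_basis[OF assms] by metis
  have fin: "finite S" using assms independent_bound by blast
  have inj: "inj_on b S"
  proof (rule inj_onI)
    fix s t assume "s \<in> S" "t \<in> S" "b s = b t"
    then show "s = t" using b(2)[of s s] b(2)[of t s] by (metis zero_neq_one)
  qed
  have coord: "t \<bullet> (\<Sum>s\<in>S. f s *\<^sub>R b s) = f t" if "t \<in> S" for f t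
  proof -
    have "t \<bullet> (\<Sum>s\<in>S. f s *\<^sub>R b s) = (\<Sum>s\<in>S. if s = t then f s else 0)"
      unfolding inner_sum_right using that by (intro sum.cong) (auto simp: b(2))
    then show ?thesis using that fin by simp
  qed
  have "independent (b ` S)"
  proof -
    have "f (b s) = 0" if "(\<Sum>v\<in>b ` S. f v *\<^sub>R v) = 0" "s \<in> S" for f s
      using coord[OF that(2), of "\<lambda>s. f (b s)"] that(1) by (simp add: sum.reindex[OF inj])
    then show ?thesis unfolding dependent_finite[OF finite_imageI[OF fin]] by blast
  qed
  moreover have "{x \<in> span S. \<forall>s\<in>S. 0 \<le> s \<bullet> x} = convex_cone hull (b ` S)"
  proof (intro equalityI subsetI)
    fix x assume x: "x \<in> {x \<in> span S. \<forall>s\<in>S. 0 \<le> s \<bullet> x}"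
    define y where "y = (\<Sum>s\<in>S. (s \<bullet> x) *\<^sub>R b s)"
    have "y \<in> span S" unfolding y_def by (intro span_sum span_scale b)
    then have "x - y \<in> span S" using x by (simp add: span_diff)
    moreover have "s \<bullet> (x - y) = 0" if "s \<in> S" for s
      using coord[OF that] by (simp add: y_def inner_diff_right)
    ultimately have "(x - y) \<bullet> (x - y) = 0"
      using orthogonal_to_span[of "x - y" S "x - y"] by (simp add: orthogonal_def inner_commute)
    then have "x = y" by simp
    have "(\<Sum>s\<in>T. (s \<bullet> x) *\<^sub>R b s) \<in> convex_cone hull (b ` S)" if "T \<subseteq> S" "finite T" for T
      using that(2,1)
    proof (induction T rule: finite_induct)
      case empty
      show ?case by (simp add: convex_cone_hull_contains_0)
    next
      case (insert s T)
      have "b s \<in> convex_cone hull (b ` S)" using insert.prems by (intro hull_inc) auto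
      then show ?case using insert x by (auto intro!: convex_cone_hull_add convex_cone_hull_mul)
    qed
    from this[OF order_refl fin] have "y \<in> convex_cone hull (b ` S)"
      by (simp only: y_def)
    then show "x \<in> convex_cone hull (b ` S)" by (simp only: \<open>x = y\<close>)
  next
    fix x assume x: "x \<in> convex_cone hull (b ` S)"
    have "convex_cone {x \<in> span S. \<forall>s\<in>S. 0 \<le> s \<bullet> x}"
      by (auto simp: convex_cone_iff span_zero span_add span_scale inner_add_right)
    moreover have "b ` S \<subseteq> {x \<in> span S. \<forall>s\<in>S. 0 \<le> s \<bullet> x}" using b by auto
    ultimately show "x \<in> {x \<in> span S. \<forall>s\<in>S. 0 \<le> s \<bullet> x}"
      using x hull_minimal by blast
  qed
  ultimately show ?thesis unfolding simplicial_cone_def by blast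
qed

lemma orthogonal_comp_span: "(span S)\<^sup>\<bottom> = {x. \<forall>s\<in>S. s \<bullet> x = 0}"
  for S :: "'a::euclidean_space set"
proof -
  have "v \<bullet> x = 0" if "\<forall>s\<in>S. s \<bullet> x = 0" "v \<in> span S" for v x
    using orthogonal_to_span[of v S x] that by (simp add: orthogonal_def inner_commute)
  then show ?thesis by (auto simp: orthogonal_comp_def orthogonal_def span_base)
qed

section \<open>Chambers of an arrangement\<close>

text \<open>Two ambient spaces occur: the whole space for the normal fan, and
  \<open>(lineal \<A>)\<^sup>\<bottom>\<close> for the essentialization. The products express "same
  sign as at \<open>c\<close>" without orienting the normals. A connected set that leaves this sign
  pattern meets a hyperplane, and each point of the closed cone is a limit of its translates by
  small positive multiples of \<open>c\<close>.\<close>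

lemma closure_component_arrangement:
  fixes a :: "'a::euclidean_space set \<Rightarrow> 'a"
  assumes V: "subspace V" and H: "\<And>H. H \<in> \<A> \<Longrightarrow> H = {x. a H \<bullet> x = 0}"
    and c: "c \<in> V" "c \<notin> \<Union>\<A>"
  shows "closure (connected_component_set (V - \<Union>\<A>) c) =
    {x \<in> V. \<forall>H\<in>\<A>. 0 \<le> (a H \<bullet> c) * (a H \<bullet> x)}" (is "closure ?K = ?R")
proof -
  let ?O = "{x \<in> V. \<forall>H\<in>\<A>. 0 < (a H \<bullet> c) * (a H \<bullet> x)}"
  have nz: "a H \<bullet> x \<noteq> 0" if "H \<in> \<A>" "x \<notin> \<Union>\<A>" for H x
    using that H by blast
  have "convex (V \<inter> (\<Inter>H\<in>\<A>. {x. 0 < ((a H \<bullet> c) *\<^sub>R a H) \<bullet> x}))"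
    using subspace_imp_convex[OF V]
    by (intro convex_Int convex_INT) (auto simp only: convex_halfspace_gt)
  also have "V \<inter> (\<Inter>H\<in>\<A>. {x. 0 < ((a H \<bullet> c) *\<^sub>R a H) \<bullet> x}) = ?O" by auto
  finally have "connected ?O" by (rule convex_connected)
  moreover have "?O \<subseteq> V - \<Union>\<A>"
  proof -
    have "a H \<bullet> x = 0" if "H \<in> \<A>" "x \<in> H" for H x using that H by blast
    then show ?thesis by fastforce
  qed
  moreover have cO: "c \<in> ?O" using c nz by (auto simp: zero_less_mult_iff linorder_neq_iff)
  ultimately have OK: "?O \<subseteq> ?K" by (intro connected_component_maximal)
  have "x \<in> ?O" if x: "x \<in> ?K" for x
  proof -
    have xV: "x \<in> V - \<Union>\<A>" using x connected_component_subset by fastforce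
    have "0 < (a H \<bullet> c) * (a H \<bullet> x)" if "H \<in> \<A>" for H
    proof (rule ccontr)
      assume "\<not> ?thesis"
      then have "a H \<bullet> x \<le> 0 \<and> 0 \<le> a H \<bullet> c \<or> a H \<bullet> c \<le> 0 \<and> 0 \<le> a H \<bullet> x"
        by (auto simp: zero_less_mult_iff not_less)
      moreover have "c \<in> ?K" using c by (simp add: connected_component_refl)
      ultimately obtain z where "z \<in> ?K" "a H \<bullet> z = 0"
        using connected_ivt_hyperplane[OF connected_connected_component, of x "V - \<Union>\<A>" c c "a H" 0]
          connected_ivt_hyperplane[OF connected_connected_component, of c "V - \<Union>\<A>" c x "a H" 0] x
        by blast
      then show False using nz[OF that, of z] connected_component_subset by fastforce
    qed
    then show ?thesis using xV by auto
  qed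
  then have K: "?K = ?O" using OK by blast
  have "closed (V \<inter> (\<Inter>H\<in>\<A>. {x. 0 \<le> ((a H \<bullet> c) *\<^sub>R a H) \<bullet> x}))"
    using closed_subspace[OF V]
    by (intro closed_Int closed_INT) (auto simp only: closed_halfspace_ge)
  also have "V \<inter> (\<Inter>H\<in>\<A>. {x. 0 \<le> ((a H \<bullet> c) *\<^sub>R a H) \<bullet> x}) = ?R" by auto
  finally have "closure ?O \<subseteq> ?R" by (intro closure_minimal) (auto intro: less_imp_le)
  moreover have "x \<in> closure ?O" if x: "x \<in> ?R" for x
  proof -
    have "x + e *\<^sub>R c \<in> ?O" if e: "0 < e" for e
    proof -
      have "0 < (a H \<bullet> c) * (a H \<bullet> (x + e *\<^sub>R c))" if "H \<in> \<A>" for H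
      proof -
        have "0 < (a H \<bullet> c) * (a H \<bullet> c)" using cO that by simp
        then have "0 < (a H \<bullet> c) * (a H \<bullet> x) + e * ((a H \<bullet> c) * (a H \<bullet> c))"
          using x that e by (intro add_nonneg_pos mult_pos_pos[of e]) auto
        also have "\<dots> = (a H \<bullet> c) * (a H \<bullet> (x + e *\<^sub>R c))"
          by (simp add: inner_add_right distrib_left)
        finally show ?thesis .
      qed
      then show ?thesis using x c V by (auto intro: subspace_add subspace_scale)
    qed
    then have "x + inverse (real (Suc n)) *\<^sub>R c \<in> ?O" for n by (simp del: mem_Collect_eq)
    moreover have "(\<lambda>n. x + inverse (real (Suc n)) *\<^sub>R c) \<longlonglongrightarrow> x + 0 *\<^sub>R c"
      by (intro tendsto_intros LIMSEQ_inverse_real_of_nat)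
    ultimately have "\<exists>f. (\<forall>n. f n \<in> ?O) \<and> f \<longlonglongrightarrow> x"
      by (intro exI[of _ "\<lambda>n. x + inverse (real (Suc n)) *\<^sub>R c"]) (simp del: mem_Collect_eq)
    then show ?thesis unfolding closure_sequential .
  qed
  ultimately show ?thesis using K by auto
qed

lemma generic_point_exists:
  assumes "hyperplane_arrangement \<A>" "open U" "U \<noteq> {}"
  obtains c where "c \<in> U" "c \<notin> \<Union>\<A>"
proof -
  have "negligible (\<Union>\<A>)"
  proof (rule negligible_Union)
    show "finite \<A>" using assms(1) by (simp add: hyperplane_arrangement_def)
    fix H assume "H \<in> \<A>"
    then obtain a where "a \<noteq> 0" "H = {x. a \<bullet> x = 0}"
      using assms(1) unfolding hyperplane_arrangement_def by blast
    then show "negligible H" by (simp add: negligible_hyperplane)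
  qed
  then have "\<not> U \<subseteq> \<Union>\<A>" using open_not_negligible[OF assms(2,3)] negligible_subset by blast
  then show ?thesis using that by blast
qed

text \<open>Normals point towards \<open>c\<^sub>0\<close>, so the base chamber is the cone on which
  all of them are nonnegative. Neighbouring and opposite chambers are needed too, hence
  \<open>chamber\<close> compares signs with an arbitrary point.\<close>

locale arrangement_chamber =
  fixes \<A> :: "'a::euclidean_space set set" and \<alpha> :: "'a set \<Rightarrow> 'a" and c\<^sub>0 :: 'a
  assumes finite_arrangement: "finite \<A>"
    and hyperplane_eq: "H \<in> \<A> \<Longrightarrow> H = {x. \<alpha> H \<bullet> x = 0}"
    and normal_pos: "H \<in> \<A> \<Longrightarrow> 0 < \<alpha> H \<bullet> c\<^sub>0"
begin

text \<open>The point \<open>p\<close> is in the relative interior of the facet that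
  \<open>H\<close> cuts out of the base chamber; that such a point exists is the working notion of a
  wall.\<close>

definition wall_point :: "'a set \<Rightarrow> 'a \<Rightarrow> bool" where
  "wall_point H p \<longleftrightarrow> H \<in> \<A> \<and> \<alpha> H \<bullet> p = 0 \<and> (\<forall>H'\<in>\<A> - {H}. 0 < \<alpha> H' \<bullet> p)"

definition generic :: "'a \<Rightarrow> bool" where
  "generic c \<longleftrightarrow> (\<forall>H\<in>\<A>. \<alpha> H \<bullet> c \<noteq> 0)"

definition chamber :: "'a \<Rightarrow> 'a set" where
  "chamber c = {x. \<forall>H\<in>\<A>. 0 \<le> (\<alpha> H \<bullet> c) * (\<alpha> H \<bullet> x)}"

lemma normal_nonzero: "H \<in> \<A> \<Longrightarrow> 0 < \<alpha> H \<bullet> \<alpha> H"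
  using normal_pos[of H] by auto

lemma generic_iff: "generic c \<longleftrightarrow> c \<notin> \<Union>\<A>"
  unfolding generic_def using hyperplane_eq by blast

lemma generic_base: "generic c\<^sub>0"
  using normal_pos by (force simp: generic_def)

lemma chamber_base: "chamber c\<^sub>0 = {x. \<forall>H\<in>\<A>. 0 \<le> \<alpha> H \<bullet> x}"
  using normal_pos by (fastforce simp: chamber_def zero_le_mult_iff)

lemma self_in_chamber: "c \<in> chamber c"
  by (simp add: chamber_def)

lemma convex_chamber: "convex (chamber c)"
proof -
  have "convex (\<Inter>H\<in>\<A>. {x. 0 \<le> ((\<alpha> H \<bullet> c) *\<^sub>R \<alpha> H) \<bullet> x})"
    by (intro convex_INT) (auto simp only: convex_halfspace_ge)
  also have "(\<Inter>H\<in>\<A>. {x. 0 \<le> ((\<alpha> H \<bullet> c) *\<^sub>R \<alpha> H) \<bullet> x}) = chamber c"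
    by (auto simp: chamber_def)
  finally show ?thesis .
qed

lemma chamber_nhd:
  assumes "generic c"
  obtains e where "0 < e" "\<And>t. \<bar>t\<bar> \<le> e \<Longrightarrow> c + t *\<^sub>R d \<in> chamber c"
proof -
  have "0 < (\<alpha> H \<bullet> c) * (\<alpha> H \<bullet> c)" if "H \<in> \<A>" for H
    using assms that by (auto simp: generic_def zero_less_mult_iff linorder_neq_iff)
  then obtain e where e: "0 < e" "\<And>H t. H \<in> \<A> \<Longrightarrow> \<bar>t\<bar> \<le> e \<Longrightarrow>
      0 < (\<alpha> H \<bullet> c) * (\<alpha> H \<bullet> c) + t * ((\<alpha> H \<bullet> c) * (\<alpha> H \<bullet> d))"
    using positive_perturbation[OF finite_arrangement,
        of "\<lambda>H. (\<alpha> H \<bullet> c) * (\<alpha> H \<bullet> c)" "\<lambda>H. (\<alpha> H \<bullet> c) * (\<alpha> H \<bullet> d)"] by blast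
  have "(\<alpha> H \<bullet> c) * (\<alpha> H \<bullet> (c + t *\<^sub>R d)) =
      (\<alpha> H \<bullet> c) * (\<alpha> H \<bullet> c) + t * ((\<alpha> H \<bullet> c) * (\<alpha> H \<bullet> d))" for H t
    by (simp add: inner_add_right distrib_left)
  then show ?thesis using e that[of e] by (auto simp: chamber_def less_imp_le)
qed

text \<open>Take a smallest family of half-spaces that still lies over the chamber. Dropping
  \<open>K\<close> admits a point \<open>x\<close> outside, and the segment from
  \<open>c\<^sub>0\<close> to \<open>x\<close> crosses \<open>K\<close> at a point where all
  remaining members of the family are strictly positive.\<close>

lemma irredundant_walls:
  obtains \<I> where "\<I> \<subseteq> \<A>" "\<And>H. H \<in> \<I> \<Longrightarrow> \<exists>p. wall_point H p"
    "\<And>x. (\<And>H. H \<in> \<I> \<Longrightarrow> 0 \<le> \<alpha> H \<bullet> x) \<Longrightarrow> x \<in> chamber c\<^sub>0"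
proof -
  define Q where "Q \<I> \<longleftrightarrow> \<I> \<subseteq> \<A> \<and> (\<forall>x. (\<forall>H\<in>\<I>. 0 \<le> \<alpha> H \<bullet> x) \<longrightarrow> x \<in> chamber c\<^sub>0)" for \<I>
  have "Q \<A>" by (simp add: Q_def chamber_base)
  then obtain \<I> where \<I>: "Q \<I>" and min: "\<And>\<J>. Q \<J> \<Longrightarrow> card \<I> \<le> card \<J>"
    using ex_has_least_nat[of Q \<A> card] by blast
  have sub: "\<I> \<subseteq> \<A>" and cone: "\<And>x. (\<And>H. H \<in> \<I> \<Longrightarrow> 0 \<le> \<alpha> H \<bullet> x) \<Longrightarrow> x \<in> chamber c\<^sub>0"
    using \<I> by (auto simp: Q_def)
  have fin: "finite \<I>" using sub finite_arrangement finite_subset by blast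
  have "\<exists>p. wall_point K p" if K: "K \<in> \<I>" for K
  proof -
    have KA: "K \<in> \<A>" using K sub by blast
    have "card (\<I> - {K}) < card \<I>" using fin K by (rule card_Diff1_less)
    then have "\<not> Q (\<I> - {K})" using min[of "\<I> - {K}"] by auto
    then obtain x where x: "\<And>H. H \<in> \<I> - {K} \<Longrightarrow> 0 \<le> \<alpha> H \<bullet> x" "x \<notin> chamber c\<^sub>0"
      using sub by (auto simp: Q_def)
    have neg: "\<alpha> K \<bullet> x < 0" using x cone[of x] by (metis Diff_iff not_less singletonD)
    have posK: "0 < \<alpha> K \<bullet> c\<^sub>0" using normal_pos KA by blast
    define t where "t = (\<alpha> K \<bullet> c\<^sub>0) / (\<alpha> K \<bullet> c\<^sub>0 - \<alpha> K \<bullet> x)"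
    have t: "0 < t" "t < 1" using posK neg by (auto simp: t_def field_simps)
    define p where "p = (1 - t) *\<^sub>R c\<^sub>0 + t *\<^sub>R x"
    have "\<alpha> K \<bullet> p = (1 - t) * (\<alpha> K \<bullet> c\<^sub>0) + t * (\<alpha> K \<bullet> x)" by (simp add: p_def inner_add_right)
    also have "\<dots> = 0" using posK neg by (simp add: t_def field_simps)
    finally have pK: "\<alpha> K \<bullet> p = 0" .
    have pI: "0 < \<alpha> H \<bullet> p" if "H \<in> \<I> - {K}" for H
    proof -
      have "0 < (1 - t) * (\<alpha> H \<bullet> c\<^sub>0)" using t normal_pos sub that by auto
      then show ?thesis using x(1)[OF that] t by (simp add: p_def inner_add_right add_pos_nonneg)
    qed
    have "0 < \<alpha> L \<bullet> p" if L: "L \<in> \<A> - {K}" for L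
    proof (rule ccontr)
      assume "\<not> 0 < \<alpha> L \<bullet> p"
      moreover have "p \<in> chamber c\<^sub>0" using pI pK by (intro cone) (metis DiffI less_imp_le order_refl singletonD)
      ultimately have Lp: "\<alpha> L \<bullet> p = 0" using L by (auto simp: chamber_base intro: antisym)
      \<comment> \<open>From \<open>p\<close> one can move both ways along \<open>h\<close> without
        leaving the chamber. As \<open>\<alpha> L\<close> is nonnegative on the chamber and zero at
        \<open>p\<close>, it must vanish on all of \<open>K\<close>.\<close>
      have "\<alpha> L \<bullet> h = 0" if h: "\<alpha> K \<bullet> h = 0" for h
      proof -
        obtain e where e: "0 < e"
          "\<And>H t. H \<in> \<I> - {K} \<Longrightarrow> \<bar>t\<bar> \<le> e \<Longrightarrow> 0 < \<alpha> H \<bullet> p + t * (\<alpha> H \<bullet> h)"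
          using positive_perturbation[of "\<I> - {K}" "\<lambda>H. \<alpha> H \<bullet> p" "\<lambda>H. \<alpha> H \<bullet> h"] fin pI
          by blast
        have "p + t *\<^sub>R h \<in> chamber c\<^sub>0" if "\<bar>t\<bar> \<le> e" for t
        proof (rule cone)
          fix H assume "H \<in> \<I>"
          then show "0 \<le> \<alpha> H \<bullet> (p + t *\<^sub>R h)"
            using e(2)[of H t] that pK h by (cases "H = K") (auto simp: inner_add_right less_imp_le)
        qed
        from this[of e] this[of "-e"] have "0 \<le> e * (\<alpha> L \<bullet> h)" "e * (\<alpha> L \<bullet> h) \<le> 0"
          using e(1) L Lp by (auto simp: chamber_base inner_add_right inner_diff_right)
        then show ?thesis using e(1) by (simp add: zero_le_mult_iff mult_le_0_iff)
      qed
      then obtain l where l: "\<alpha> L = l *\<^sub>R \<alpha> K" using multiple_of_normal by blast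
      then have "l \<noteq> 0" using normal_nonzero[of L] L by auto
      then have "L = K" using hyperplane_eq[of L] hyperplane_eq[of K] KA L l by auto
      then show False using L by simp
    qed
    then show ?thesis using KA pK by (auto simp: wall_point_def)
  qed
  then show ?thesis using that sub cone by blast
qed

lemma wall_point_in_chamber:
  assumes "wall_point K p"
  shows "p \<in> chamber c\<^sub>0"
proof -
  have "0 \<le> \<alpha> H \<bullet> p" if "H \<in> \<A>" for H
    using assms that by (cases "H = K") (auto simp: wall_point_def less_imp_le)
  then show ?thesis by (simp add: chamber_base)
qed

lemma wall_neighbour:
  assumes "wall_point K p"
  obtains d where "\<And>H. H \<in> \<A> - {K} \<Longrightarrow> 0 < \<alpha> H \<bullet> d" "\<alpha> K \<bullet> d < 0"
proof -
  have K: "K \<in> \<A>" "\<alpha> K \<bullet> p = 0" and p: "\<And>H. H \<in> \<A> - {K} \<Longrightarrow> 0 < \<alpha> H \<bullet> p"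
    using assms by (auto simp: wall_point_def)
  obtain e where e: "0 < e"
    "\<And>H t. H \<in> \<A> - {K} \<Longrightarrow> \<bar>t\<bar> \<le> e \<Longrightarrow> 0 < \<alpha> H \<bullet> p + t * (\<alpha> H \<bullet> \<alpha> K)"
    using positive_perturbation[of "\<A> - {K}" "\<lambda>H. \<alpha> H \<bullet> p" "\<lambda>H. \<alpha> H \<bullet> \<alpha> K"]
      finite_arrangement p by blast
  have "0 < \<alpha> H \<bullet> (p + (-e) *\<^sub>R \<alpha> K)" if "H \<in> \<A> - {K}" for H
    using e(2)[OF that, of "-e"] e(1) by (simp add: inner_diff_right)
  moreover have "\<alpha> K \<bullet> (p + (-e) *\<^sub>R \<alpha> K) < 0"
    using K e(1) normal_nonzero[OF K(1)] by (simp add: inner_diff_right)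
  ultimately show ?thesis using that by blast
qed

lemma lineal_eq: "lineal \<A> = {x. \<forall>H\<in>\<A>. \<alpha> H \<bullet> x = 0}"
  unfolding lineal_def using hyperplane_eq by blast

text \<open>If all normals of the family vanish at \<open>x\<close>, then \<open>x\<close> and
  \<open>- x\<close> both lie in the chamber, so \<open>x\<close> is in its lineality space. Hence
  the wall normals alone already span the essential part.\<close>

lemma span_normals:
  assumes "\<I> \<subseteq> \<A>" "\<And>x. (\<And>H. H \<in> \<I> \<Longrightarrow> 0 \<le> \<alpha> H \<bullet> x) \<Longrightarrow> x \<in> chamber c\<^sub>0"
  shows "span (\<alpha> ` \<I>) = (lineal \<A>)\<^sup>\<bottom>"
proof -
  have "x \<in> lineal \<A>" if x: "\<forall>H\<in>\<I>. \<alpha> H \<bullet> x = 0" for x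
  proof -
    have "x \<in> chamber c\<^sub>0" "- x \<in> chamber c\<^sub>0" using x by (auto intro!: assms(2))
    then show ?thesis by (auto simp: chamber_base lineal_eq intro: antisym)
  qed
  then have "lineal \<A> = (span (\<alpha> ` \<I>))\<^sup>\<bottom>"
    using assms(1) by (auto simp: orthogonal_comp_span lineal_eq)
  then show ?thesis by (simp add: orthogonal_comp_self)
qed

end

lemma arrangement_chamber_exists:
  assumes "hyperplane_arrangement \<A>" "c \<notin> \<Union>\<A>"
  obtains \<alpha> where "arrangement_chamber \<A> \<alpha> c"
proof -
  obtain a where a: "\<And>H. H \<in> \<A> \<Longrightarrow> a H \<noteq> 0" "\<And>H. H \<in> \<A> \<Longrightarrow> H = {x. a H \<bullet> x = 0}"
    using assms(1) unfolding hyperplane_arrangement_def by metis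
  have nz: "a H \<bullet> c \<noteq> 0" if "H \<in> \<A>" for H using a(2)[OF that] assms(2) that by blast
  \<comment> \<open>The factor \<open>a H \<bullet> c\<close> orients the normal, because its value
    at \<open>c\<close> becomes a nonzero square.\<close>
  have "arrangement_chamber \<A> (\<lambda>H. (a H \<bullet> c) *\<^sub>R a H) c"
  proof
    show "finite \<A>" using assms(1) by (simp add: hyperplane_arrangement_def)
    show "H = {x. (a H \<bullet> c) *\<^sub>R a H \<bullet> x = 0}" if "H \<in> \<A>" for H
      using a(2)[OF that] nz[OF that] by simp
    show "0 < (a H \<bullet> c) *\<^sub>R a H \<bullet> c" if "H \<in> \<A>" for H
      using nz[OF that] by (auto simp: zero_less_mult_iff linorder_neq_iff)
  qed
  then show ?thesis by (rule that)
qed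

section \<open>Chambers of an inscribed polytope\<close>

locale inscribed_chamber = arrangement_chamber +
  fixes P z r
  assumes polytope: "polytope P"
    and fan_eq: "normal_fan P = arrangement_fan \<A>"
    and on_sphere: "v extreme_point_of P \<Longrightarrow> v \<in> sphere z r"
begin

text \<open>Equality of fans only supplies some face \<open>F\<close>. All functionals in its normal
  cone are constant on \<open>F\<close>; since a generic \<open>c\<close> may be tilted in the
  direction \<open>x - v\<close> for \<open>x\<close> and \<open>v\<close> in \<open>F\<close>, the
  face is a single point.\<close>

lemma chamber_normal_cone:
  assumes c: "generic c"
  shows "\<exists>v\<in>P. chamber c = normal_cone P {v}"
proof -
  have "closure (connected_component_set (UNIV - \<Union>\<A>) c) = chamber c"
    using closure_component_arrangement[OF subspace_UNIV hyperplane_eq, of \<A> c] c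
    by (simp add: generic_iff chamber_def)
  moreover have "connected_component_set (UNIV - \<Union>\<A>) c \<in> components (UNIV - \<Union>\<A>)"
    using c by (auto simp: generic_iff components_def)
  ultimately have "chamber c \<in> regions UNIV \<A>" unfolding regions_def by (metis imageI)
  then have "chamber c \<in> arrangement_fan \<A>"
    using face_of_refl[OF convex_chamber] self_in_chamber unfolding arrangement_fan_def by blast
  then obtain F where F: "chamber c = normal_cone P F" "F face_of P" "F \<noteq> {}"
    unfolding fan_eq[symmetric] normal_fan_def by blast
  then obtain v where v: "v \<in> F" by blast
  have FP: "F \<subseteq> P" using F(2) by (rule face_of_imp_subset)
  have "x = v" if x: "x \<in> F" for x
  proof -
    obtain e where e: "0 < e" "\<And>t. \<bar>t\<bar> \<le> e \<Longrightarrow> c + t *\<^sub>R (x - v) \<in> chamber c"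
      using chamber_nhd[OF c] by blast
    have const: "q \<bullet> x = q \<bullet> v" if "q \<in> chamber c" for q
    proof (rule antisym)
      have q: "q \<in> normal_cone P F" using that F(1) by simp
      show "q \<bullet> x \<le> q \<bullet> v" "q \<bullet> v \<le> q \<bullet> x"
        using q x v FP by (auto simp: normal_cone_def)
    qed
    have "(c + e *\<^sub>R (x - v)) \<bullet> (x - v) = 0" "c \<bullet> (x - v) = 0"
      using const[OF e(2)[of e]] const[OF self_in_chamber] e(1) by (simp_all add: inner_diff_right)
    then have "(x - v) \<bullet> (x - v) = 0" using e(1) by (simp add: inner_add_left)
    then show ?thesis by simp
  qed
  then have "F = {v}" using v by blast
  then show ?thesis using F FP by auto
qed

text \<open>For generic \<open>c\<close> this is the only maximiser of \<open>c\<close> on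
  \<open>P\<close>, by \<open>vert_unique\<close>; choosing it through its normal cone makes
  \<open>chamber_eq\<close> immediate.\<close>

definition vert :: "'a \<Rightarrow> 'a" where
  "vert c = (SOME v. v \<in> P \<and> chamber c = normal_cone P {v})"

context
  fixes c assumes c: "generic c"
begin

lemma vert_in: "vert c \<in> P" and chamber_eq: "chamber c = normal_cone P {vert c}"
proof -
  have "vert c \<in> P \<and> chamber c = normal_cone P {vert c}"
    unfolding vert_def by (rule someI_ex) (use chamber_normal_cone[OF c] in blast)
  then show "vert c \<in> P" "chamber c = normal_cone P {vert c}" by blast+
qed

lemma vert_max: "x \<in> chamber c \<Longrightarrow> y \<in> P \<Longrightarrow> x \<bullet> y \<le> x \<bullet> vert c"
  by (simp add: chamber_eq normal_cone_def)

text \<open>Tilting \<open>c\<close> slightly towards a competing maximiser stays in the chamber and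
  would make the competitor strictly better.\<close>

lemma vert_unique:
  assumes "y \<in> P" "c \<bullet> vert c \<le> c \<bullet> y"
  shows "y = vert c"
proof -
  define d where "d = y - vert c"
  obtain e where e: "0 < e" "\<And>t. \<bar>t\<bar> \<le> e \<Longrightarrow> c + t *\<^sub>R d \<in> chamber c"
    using chamber_nhd[OF c] by blast
  have "(c + e *\<^sub>R d) \<bullet> y \<le> (c + e *\<^sub>R d) \<bullet> vert c"
    using vert_max[OF e(2)[of e] assms(1)] e(1) by simp
  then have "c \<bullet> d + e * (d \<bullet> d) \<le> 0" by (simp add: d_def inner_add_left inner_diff_right algebra_simps)
  moreover have "0 \<le> c \<bullet> d" using assms(2) by (simp add: d_def inner_diff_right)
  ultimately have "e * (d \<bullet> d) \<le> 0" by simp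
  then have "d \<bullet> d \<le> 0" using e(1) by (simp add: mult_le_0_iff)
  then have "d = 0" by (metis inner_eq_zero_iff inner_ge_zero order_antisym)
  then show ?thesis by (simp add: d_def)
qed

lemma vert_extreme: "vert c extreme_point_of P"
proof -
  have "P \<inter> {x. c \<bullet> x = c \<bullet> vert c} face_of P"
    using polytope_imp_convex[OF polytope] vert_max[OF self_in_chamber]
    by (intro face_of_Int_supporting_hyperplane_le) auto
  moreover have "P \<inter> {x. c \<bullet> x = c \<bullet> vert c} = {vert c}"
    using vert_in vert_unique by force
  ultimately show ?thesis by (simp add: face_of_singleton)
qed

lemma vert_sphere: "(vert c - z) \<bullet> (vert c - z) = r\<^sup>2"
  using on_sphere[OF vert_extreme] by (simp add: dist_norm norm_minus_commute dot_square_norm)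

end

section \<open>Vertices of adjacent chambers\<close>

lemma vert_common:
  assumes "generic c" "generic d" "q \<in> chamber c" "q \<in> chamber d"
  shows "q \<bullet> vert c = q \<bullet> vert d"
  using vert_max[OF assms(1,3) vert_in[OF assms(2)]] vert_max[OF assms(2,4) vert_in[OF assms(1)]]
  by simp

text \<open>A vertex determines its normal cone and hence its chamber, so points on different sides
  of a hyperplane have different vertices.\<close>

lemma vert_separates:
  assumes "generic c" "generic d" "vert c = vert d" "H \<in> \<A>"
  shows "0 < (\<alpha> H \<bullet> c) * (\<alpha> H \<bullet> d)"
proof -
  have "d \<in> chamber c"
    using chamber_eq[OF assms(1)] chamber_eq[OF assms(2)] assms(3) self_in_chamber[of d] by simp
  then have "0 \<le> (\<alpha> H \<bullet> c) * (\<alpha> H \<bullet> d)" using assms(4) by (simp add: chamber_def)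
  moreover have "(\<alpha> H \<bullet> c) * (\<alpha> H \<bullet> d) \<noteq> 0" using assms by (simp add: generic_def)
  ultimately show ?thesis by linarith
qed

text \<open>Here \<open>p\<close> is any point lying on \<open>K\<close> alone, because the lemma is
  applied at a wall point of the base chamber and also at the point \<open>p'\<close> of
  \<open>projection_in_chamber\<close>. Both chambers contain a neighbourhood of \<open>p\<close> in
  \<open>K\<close>, where the two vertices give equal values; so they differ by a multiple of
  \<open>\<alpha> K\<close>. The sphere enters through their equal distance to
  \<open>z\<close>.\<close>

lemma wall_crossing:
  assumes K: "K \<in> \<A>" "\<alpha> K \<bullet> p = 0"
    and c: "\<And>H. H \<in> \<A> - {K} \<Longrightarrow> 0 < (\<alpha> H \<bullet> c) * (\<alpha> H \<bullet> p)" "0 < \<alpha> K \<bullet> c"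
    and d: "\<And>H. H \<in> \<A> - {K} \<Longrightarrow> 0 < (\<alpha> H \<bullet> d) * (\<alpha> H \<bullet> p)" "\<alpha> K \<bullet> d < 0"
  shows "\<exists>l>0. vert c - vert d = l *\<^sub>R \<alpha> K"
    and "\<alpha> K \<bullet> (vert d - z) = - (\<alpha> K \<bullet> (vert c - z))"
proof -
  have gc: "generic c" and gd: "generic d"
    using c d by (fastforce simp: generic_def)+
  have perturb: "\<exists>e>0. \<forall>t. \<bar>t\<bar> \<le> e \<longrightarrow> p + t *\<^sub>R h \<in> chamber q"
    if h: "\<alpha> K \<bullet> h = 0" and q: "\<And>H. H \<in> \<A> - {K} \<Longrightarrow> 0 < (\<alpha> H \<bullet> q) * (\<alpha> H \<bullet> p)" for h q
  proof -
    obtain e where e: "0 < e" "\<And>H t. H \<in> \<A> - {K} \<Longrightarrow> \<bar>t\<bar> \<le> e \<Longrightarrow>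
        0 < (\<alpha> H \<bullet> q) * (\<alpha> H \<bullet> p) + t * ((\<alpha> H \<bullet> q) * (\<alpha> H \<bullet> h))"
      using positive_perturbation[of "\<A> - {K}" "\<lambda>H. (\<alpha> H \<bullet> q) * (\<alpha> H \<bullet> p)"
          "\<lambda>H. (\<alpha> H \<bullet> q) * (\<alpha> H \<bullet> h)"] finite_arrangement q by blast
    have "0 \<le> (\<alpha> H \<bullet> q) * (\<alpha> H \<bullet> (p + t *\<^sub>R h))" if "H \<in> \<A>" "\<bar>t\<bar> \<le> e" for H t
    proof (cases "H = K")
      case True
      then show ?thesis using K h by (simp add: inner_add_right)
    next
      case False
      then show ?thesis using e(2)[of H t] that by (simp add: inner_add_right algebra_simps)
    qed
    then show ?thesis using e(1) by (auto simp: chamber_def)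
  qed
  define v where "v = vert c"
  define w where "w = vert d"
  have eq: "q \<bullet> v = q \<bullet> w" if "q \<in> chamber c" "q \<in> chamber d" for q
    using vert_common[OF gc gd that] by (simp add: v_def w_def)
  have "(v - w) \<bullet> h = 0" if h: "\<alpha> K \<bullet> h = 0" for h
  proof -
    obtain e1 where e1: "e1 > 0" "\<And>t. \<bar>t\<bar> \<le> e1 \<Longrightarrow> p + t *\<^sub>R h \<in> chamber c"
      using perturb[OF h c(1)] by auto
    obtain e2 where e2: "e2 > 0" "\<And>t. \<bar>t\<bar> \<le> e2 \<Longrightarrow> p + t *\<^sub>R h \<in> chamber d"
      using perturb[OF h d(1)] by auto
    define e where "e = min e1 e2"
    have e: "e > 0" "p + e *\<^sub>R h \<in> chamber c" "p + e *\<^sub>R h \<in> chamber d" "p \<in> chamber c" "p \<in> chamber d"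
      using e1 e2 e1(2)[of e] e2(2)[of e] e1(2)[of 0] e2(2)[of 0] by (auto simp: e_def)
    then have "e * (h \<bullet> v) = e * (h \<bullet> w)"
      using eq[OF e(2,3)] eq[OF e(4,5)] by (simp add: inner_add_left)
    then show ?thesis using e(1) by (simp add: inner_diff_right inner_commute[of _ h])
  qed
  then obtain l where l: "v - w = l *\<^sub>R \<alpha> K" using multiple_of_normal[of "\<alpha> K" "v - w"] by blast
  have "v \<noteq> w" using vert_separates[OF gc gd _ K(1)] c(2) d(2) by (auto simp: v_def w_def zero_less_mult_iff)
  then have "l \<noteq> 0" using l by auto
  have "0 \<le> c \<bullet> (v - w)" using vert_max[OF gc self_in_chamber vert_in[OF gd]]
    by (simp add: v_def w_def inner_diff_right)
  then have "0 \<le> l * (\<alpha> K \<bullet> c)" by (simp add: l inner_commute)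
  then have lpos: "l > 0" using c(2) \<open>l \<noteq> 0\<close> by (simp add: zero_le_mult_iff)
  then show "\<exists>l>0. vert c - vert d = l *\<^sub>R \<alpha> K" using l by (auto simp: v_def w_def)
  have "(v - z) \<bullet> (v - z) = (w - z) \<bullet> (w - z)"
    using vert_sphere[OF gc] vert_sphere[OF gd] by (simp add: v_def w_def)
  \<comment> \<open>A difference of squares: the midpoint of the two vertices lies on the translate
    of \<open>K\<close> through \<open>z\<close>.\<close>
  then have "(v - w) \<bullet> ((v - z) + (w - z)) = 0"
    by (simp add: inner_diff_left inner_diff_right inner_add_right inner_commute)
  then have "\<alpha> K \<bullet> ((v - z) + (w - z)) = 0" using lpos by (simp add: l)
  then show "\<alpha> K \<bullet> (vert d - z) = - (\<alpha> K \<bullet> (vert c - z))"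
    by (simp add: v_def w_def inner_add_right)
qed

lemma projection_in_chamber:
  assumes wall: "wall_point K p" and x: "x \<in> chamber c\<^sub>0"
  shows "x - ((\<alpha> K \<bullet> x) / (\<alpha> K \<bullet> \<alpha> K)) *\<^sub>R \<alpha> K \<in> chamber c\<^sub>0"
proof (rule ccontr)
  define s where "s = (\<alpha> K \<bullet> x) / (\<alpha> K \<bullet> \<alpha> K)"
  define q where "q = x - s *\<^sub>R \<alpha> K"
  assume "x - ((\<alpha> K \<bullet> x) / (\<alpha> K \<bullet> \<alpha> K)) *\<^sub>R \<alpha> K \<notin> chamber c\<^sub>0"
  then have "q \<notin> chamber c\<^sub>0" by (simp add: q_def s_def)
  then obtain k where k: "k \<in> \<A>" "\<alpha> k \<bullet> q < 0" by (auto simp: chamber_base not_le)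
  have K: "K \<in> \<A>" "\<alpha> K \<bullet> p = 0" and p: "\<And>H. H \<in> \<A> - {K} \<Longrightarrow> 0 < \<alpha> H \<bullet> p"
    using wall by (auto simp: wall_point_def)
  have qK: "\<alpha> K \<bullet> q = 0" using normal_nonzero[OF K(1)] by (simp add: q_def s_def inner_diff_right)
  have "0 \<le> s" using x K normal_nonzero[OF K(1)] by (auto simp: s_def chamber_base)
  have "k \<in> \<A> - {K}" using k qK by auto
  then obtain t m where t: "0 < t" "t < 1"
    "\<And>H. H \<in> \<A> - {K} \<Longrightarrow> 0 \<le> (1 - t) * (\<alpha> H \<bullet> p) + t * (\<alpha> H \<bullet> q)"
    and m: "m \<in> \<A> - {K}" "(1 - t) * (\<alpha> m \<bullet> p) + t * (\<alpha> m \<bullet> q) = 0"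
    using first_exit[of "\<A> - {K}" "\<lambda>H. \<alpha> H \<bullet> p" k "\<lambda>H. \<alpha> H \<bullet> q"] finite_arrangement p k(2) by blast
  define y where "y = (1 - t) *\<^sub>R p + t *\<^sub>R q"
  have y: "\<alpha> H \<bullet> y = (1 - t) * (\<alpha> H \<bullet> p) + t * (\<alpha> H \<bullet> q)" for H
    by (simp add: y_def inner_add_right)
  have yK: "\<alpha> K \<bullet> y = 0" using K qK by (simp add: y)
  have y_nonneg: "0 \<le> \<alpha> H \<bullet> y" if "H \<in> \<A>" for H
    using t(3)[of H] that yK y[of H] by (cases "H = K") auto
  have ym: "\<alpha> m \<bullet> y = 0" using m y by simp
  \<comment> \<open>The segment from \<open>p\<close> to \<open>q\<close> runs inside \<open>K\<close>, so every other hyperplane through its exit point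
    \<open>y\<close> is left strictly, and this forces an acute angle with the normal of \<open>K\<close>.\<close>
  have acute: "0 < \<alpha> H \<bullet> \<alpha> K" if H: "H \<in> \<A> - {K}" "\<alpha> H \<bullet> y = 0" for H
  proof -
    have "0 < (1 - t) * (\<alpha> H \<bullet> p)" using p[OF H(1)] t by simp
    then have "t * (\<alpha> H \<bullet> q) < 0" using H(2) y[of H] by simp
    then have "\<alpha> H \<bullet> q < 0" using t by (simp add: mult_less_0_iff)
    moreover have "0 \<le> \<alpha> H \<bullet> x" using x H by (auto simp: chamber_base)
    ultimately have "0 < s * (\<alpha> H \<bullet> \<alpha> K)" by (simp add: q_def inner_diff_right)
    then show ?thesis using \<open>0 \<le> s\<close> by (simp add: zero_less_mult_iff)
  qed
  define N where "N = {H \<in> \<A>. 0 < \<alpha> H \<bullet> y}"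
  have N: "finite N" "\<And>H. H \<in> N \<Longrightarrow> 0 < \<alpha> H \<bullet> y" using finite_arrangement by (auto simp: N_def)
  have notN: "\<alpha> H \<bullet> y = 0" if "H \<in> \<A>" "H \<notin> N" for H
    using that y_nonneg[of H] by (auto simp: N_def)
  obtain e where e: "0 < e" "\<And>H t. H \<in> N \<Longrightarrow> \<bar>t\<bar> \<le> e \<Longrightarrow> 0 < \<alpha> H \<bullet> y + t * (\<alpha> H \<bullet> \<alpha> K)"
    using positive_perturbation[of N "\<lambda>H. \<alpha> H \<bullet> y" "\<lambda>H. \<alpha> H \<bullet> \<alpha> K"] N by blast
  obtain e' where e': "0 < e'" "\<And>H t. H \<in> N \<Longrightarrow> \<bar>t\<bar> \<le> e' \<Longrightarrow> 0 < \<alpha> H \<bullet> y + t * (\<alpha> H \<bullet> (p - y))"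
    using positive_perturbation[of N "\<lambda>H. \<alpha> H \<bullet> y" "\<lambda>H. \<alpha> H \<bullet> (p - y)"] N by blast
  define a where "a = y + e *\<^sub>R \<alpha> K"
  define b where "b = y - e *\<^sub>R \<alpha> K"
  \<comment> \<open>This prolongs the segment from \<open>p\<close> beyond \<open>y\<close> inside
    \<open>K\<close>. Hyperplanes through \<open>y\<close> other than \<open>K\<close> change sign
    and all others keep theirs, so \<open>p'\<close> lies on \<open>K\<close> alone; it will
    separate the chamber of \<open>b\<close> from that of its mirror image
    \<open>b'\<close>.\<close>
  define p' where "p' = y - e' *\<^sub>R (p - y)"
  \<comment> \<open>By \<open>acute\<close>, \<open>a\<close> and \<open>b\<close> lie on different sides of every hyperplane through \<open>y\<close>, so the chambers
    of \<open>c\<^sub>0\<close> and \<open>b\<close> are opposite at \<open>y\<close>. Over the face of \<open>P\<close> maximising \<open>y\<close>, the normal of \<open>K\<close> thus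
    has its maximum at \<open>vert c\<^sub>0\<close> and its unique minimum at \<open>vert b\<close>. The mirror images \<open>vert d\<close> and
    \<open>vert b'\<close> of these two vertices lie in the same face, which forces \<open>vert d = vert b\<close>.\<close>
  have "0 \<le> \<alpha> H \<bullet> a" if "H \<in> \<A>" for H
    using e(2)[of H e] e(1) notN[of H] acute[of H] normal_nonzero[OF K(1)] that
    by (cases "H \<in> N"; cases "H = K") (auto simp: a_def inner_add_right yK less_imp_le)
  then have a: "a \<in> chamber c\<^sub>0" by (simp add: chamber_base)
  have bN: "0 < \<alpha> H \<bullet> b" and p'N: "0 < \<alpha> H \<bullet> p'" if "H \<in> N" for H
    using e(2)[OF that, of "-e"] e(1) e'(2)[OF that, of "-e'"] e'(1)
    by (auto simp: b_def p'_def inner_diff_right)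
  have bZ: "\<alpha> H \<bullet> b < 0" and p'Z: "\<alpha> H \<bullet> p' < 0" if "H \<in> \<A> - {K}" "H \<notin> N" for H
    using notN[of H] acute[of H] p[of H] that e(1) e'(1)
    by (auto simp: b_def p'_def inner_diff_right)
  have bK: "\<alpha> K \<bullet> b < 0" and p'K: "\<alpha> K \<bullet> p' = 0"
    using yK K e(1) normal_nonzero[OF K(1)] by (auto simp: b_def p'_def inner_diff_right)
  have "0 < (\<alpha> H \<bullet> p') * (\<alpha> H \<bullet> p')" if "H \<in> \<A> - {K}" for H
    using p'N[of H] p'Z[OF that] by (cases "H \<in> N") (auto simp: mult_neg_neg)
  then obtain e'' where e'': "0 < e''" "\<And>H t. H \<in> \<A> - {K} \<Longrightarrow> \<bar>t\<bar> \<le> e'' \<Longrightarrow>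
      0 < (\<alpha> H \<bullet> p') * (\<alpha> H \<bullet> p') + t * ((\<alpha> H \<bullet> \<alpha> K) * (\<alpha> H \<bullet> p'))"
    using positive_perturbation[of "\<A> - {K}" "\<lambda>H. (\<alpha> H \<bullet> p') * (\<alpha> H \<bullet> p')"
        "\<lambda>H. (\<alpha> H \<bullet> \<alpha> K) * (\<alpha> H \<bullet> p')"] finite_arrangement by blast
  define b' where "b' = p' + e'' *\<^sub>R \<alpha> K"
  have b'p': "0 < (\<alpha> H \<bullet> b') * (\<alpha> H \<bullet> p')" if "H \<in> \<A> - {K}" for H
    using e''(2)[OF that, of e''] e''(1) by (simp add: b'_def inner_add_right algebra_simps)
  have b'K: "0 < \<alpha> K \<bullet> b'"
    using p'K e''(1) normal_nonzero[OF K(1)] by (simp add: b'_def inner_add_right)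
  have bp': "0 < (\<alpha> H \<bullet> b) * (\<alpha> H \<bullet> p')" if "H \<in> \<A> - {K}" for H
    using bN[of H] p'N[of H] bZ[OF that] p'Z[OF that] by (cases "H \<in> N") (auto simp: mult_neg_neg)
  obtain d where d: "\<And>H. H \<in> \<A> - {K} \<Longrightarrow> 0 < \<alpha> H \<bullet> d" "\<alpha> K \<bullet> d < 0"
    using wall_neighbour[OF wall] by blast
  have gen: "generic d" "generic b" "generic b'"
    unfolding generic_def using d bp' bK b'p' b'K by (metis DiffI less_irrefl mult_zero_left singletonD)+
  have y_in: "y \<in> chamber c" if "\<And>H. H \<in> N \<Longrightarrow> 0 \<le> \<alpha> H \<bullet> c" for c
    unfolding chamber_def using that notN N(2) by (force simp: less_imp_le)
  have NK: "H \<in> \<A> - {K}" if "H \<in> N" for H using that yK by (auto simp: N_def)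
  have y_chamber: "y \<in> chamber c\<^sub>0" "y \<in> chamber d" "y \<in> chamber b" "y \<in> chamber b'"
    using normal_pos d(1) bN b'p' p'N NK
    by (auto intro!: y_in simp: less_imp_le N_def) (metis less_imp_le zero_less_mult_pos2)
  note gen0 = generic_base
  have "\<alpha> K \<bullet> (vert d - z) = - (\<alpha> K \<bullet> (vert c\<^sub>0 - z))"
    by (rule wall_crossing(2)[OF K]) (use d p normal_pos K in auto)
  moreover have "\<alpha> K \<bullet> (vert b - z) = - (\<alpha> K \<bullet> (vert b' - z))"
    by (rule wall_crossing(2)[OF K(1) p'K b'p' b'K bp' bK])
  moreover have "\<alpha> K \<bullet> vert b' \<le> \<alpha> K \<bullet> vert c\<^sub>0"
  proof -
    \<comment> \<open>Both vertices give \<open>y\<close> the same value, so comparing them under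
      \<open>a = y + e *\<^sub>R \<alpha> K\<close> compares their heights along
      \<open>\<alpha> K\<close>.\<close>
    have "e * (\<alpha> K \<bullet> vert b') \<le> e * (\<alpha> K \<bullet> vert c\<^sub>0)"
      using vert_max[OF gen0 a vert_in[OF gen(3)]] vert_common[OF gen0 gen(3) y_chamber(1,4)]
      by (simp add: a_def inner_add_left)
    then show ?thesis using e(1) by simp
  qed
  \<comment> \<open>Both heights over \<open>z\<close> are replaced by the negatives of their mirror
    values, which reverses the inequality.\<close>
  ultimately have "\<alpha> K \<bullet> vert d \<le> \<alpha> K \<bullet> vert b" by (simp add: inner_diff_right)
  then have "b \<bullet> vert b \<le> b \<bullet> vert d"
    using vert_common[OF gen(1,2) y_chamber(2,3)] e(1) by (simp add: b_def inner_diff_left)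
  then have "vert d = vert b" using vert_unique[OF gen(2) vert_in[OF gen(1)]] by simp
  \<comment> \<open>The hyperplane \<open>m\<close> through \<open>y\<close> is positive at
    \<open>d\<close>, which differs from the base chamber across \<open>K\<close> only, and negative
    at \<open>b\<close>.\<close>
  then have "0 < (\<alpha> m \<bullet> d) * (\<alpha> m \<bullet> b)" using vert_separates[OF gen(1,2)] m by simp
  moreover have "0 < \<alpha> m \<bullet> d" "\<alpha> m \<bullet> b < 0" using d(1)[OF m(1)] bZ[OF m(1)] ym N(2)[of m] by auto
  ultimately show False by (simp add: zero_less_mult_iff)
qed

text \<open>Projecting \<open>p\<close> onto \<open>K\<close> moves it by a negative multiple of
  \<open>\<alpha> K\<close>. The result is still in the chamber, although \<open>\<alpha> H\<close>
  was zero at \<open>p\<close>; so \<open>\<alpha> H\<close> cannot increase along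
  \<open>\<alpha> K\<close>.\<close>

lemma walls_obtuse:
  assumes "wall_point H p" "wall_point K q" "H \<noteq> K"
  shows "\<alpha> H \<bullet> \<alpha> K \<le> 0"
proof -
  have H: "H \<in> \<A>" "\<alpha> H \<bullet> p = 0" and K: "K \<in> \<A>" "0 < \<alpha> K \<bullet> p"
    using assms by (auto simp: wall_point_def)
  define s where "s = (\<alpha> K \<bullet> p) / (\<alpha> K \<bullet> \<alpha> K)"
  have "0 < s" using K normal_nonzero[OF K(1)] by (simp add: s_def)
  moreover have "p - s *\<^sub>R \<alpha> K \<in> chamber c\<^sub>0"
    unfolding s_def by (rule projection_in_chamber[OF assms(2) wall_point_in_chamber[OF assms(1)]])
  then have "s * (\<alpha> H \<bullet> \<alpha> K) \<le> 0" using H by (auto simp: chamber_base inner_diff_right)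
  ultimately show ?thesis by (simp add: mult_le_0_iff)
qed

text \<open>The interior point \<open>c\<^sub>0\<close> serves as the positive functional.
  Injectivity is recorded so that walls can be counted by their normals; equal normals would have a
  positive inner product.\<close>

lemma wall_normals_independent:
  assumes "\<I> \<subseteq> \<A>" "\<And>H. H \<in> \<I> \<Longrightarrow> \<exists>p. wall_point H p"
  shows "independent (\<alpha> ` \<I>)" "inj_on \<alpha> \<I>"
proof -
  have obtuse: "\<alpha> H \<bullet> \<alpha> K \<le> 0" if "H \<in> \<I>" "K \<in> \<I>" "H \<noteq> K" for H K
    using that assms(2) walls_obtuse by blast
  show "inj_on \<alpha> \<I>"
  proof (rule inj_onI, rule ccontr)
    fix H K assume "H \<in> \<I>" "K \<in> \<I>" "\<alpha> H = \<alpha> K" "H \<noteq> K"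
    moreover from this have "K \<in> \<A>" using assms(1) by blast
    ultimately show False using obtuse[of H K] normal_nonzero[of K] by (metis not_less)
  qed
  show "independent (\<alpha> ` \<I>)"
  proof (rule independent_if_obtuse)
    show "finite (\<alpha> ` \<I>)" using assms(1) finite_arrangement finite_subset by blast
    show "s \<bullet> t \<le> 0" if "s \<in> \<alpha> ` \<I>" "t \<in> \<alpha> ` \<I>" "s \<noteq> t" for s t using that obtuse by auto
    show "0 < s \<bullet> c\<^sub>0" if "s \<in> \<alpha> ` \<I>" for s using that normal_pos assms(1) by auto
  qed
qed

lemma simplicial_cone_chamber: "simplicial_cone ((lineal \<A>)\<^sup>\<bottom> \<inter> chamber c\<^sub>0)"
proof -
  obtain \<I> where I: "\<I> \<subseteq> \<A>" "\<And>H. H \<in> \<I> \<Longrightarrow> \<exists>p. wall_point H p"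
    "\<And>x. (\<And>H. H \<in> \<I> \<Longrightarrow> 0 \<le> \<alpha> H \<bullet> x) \<Longrightarrow> x \<in> chamber c\<^sub>0"
    using irredundant_walls by blast
  have "chamber c\<^sub>0 = {x. \<forall>s\<in>\<alpha> ` \<I>. 0 \<le> s \<bullet> x}"
    using I(1,3) by (auto simp: chamber_base)
  then have "(lineal \<A>)\<^sup>\<bottom> \<inter> chamber c\<^sub>0 = {x \<in> span (\<alpha> ` \<I>). \<forall>s\<in>\<alpha> ` \<I>. 0 \<le> s \<bullet> x}"
    using span_normals[OF I(1,3)] by auto
  then show ?thesis
    using simplicial_cone_of_independent_normals[OF wall_normals_independent(1)[OF I(1,2)]] by simp
qed

section \<open>Dimension and edges of the polytope\<close>

lemma lineal_constant: "lineal \<A> = {c. \<forall>x\<in>P. c \<bullet> x = c \<bullet> vert c\<^sub>0}"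
proof (intro equalityI subsetI)
  fix c assume c: "c \<in> lineal \<A>"
  then have "c \<in> chamber c\<^sub>0" "- c \<in> chamber c\<^sub>0" by (auto simp: chamber_base lineal_eq)
  then have "c \<bullet> x = c \<bullet> vert c\<^sub>0" if "x \<in> P" for x
    using vert_max[OF generic_base _ that, of c] vert_max[OF generic_base _ that, of "- c"] by simp
  then show "c \<in> {c. \<forall>x\<in>P. c \<bullet> x = c \<bullet> vert c\<^sub>0}" by simp
next
  fix c assume c: "c \<in> {c. \<forall>x\<in>P. c \<bullet> x = c \<bullet> vert c\<^sub>0}"
  \<comment> \<open>A functional constant on \<open>P\<close> may be added in any multiple without
    changing the maximisers. Each normal is thus nonnegative along a whole line, which forces its
    slope there to be zero.\<close>
  have "c\<^sub>0 + t *\<^sub>R c \<in> chamber c\<^sub>0" for t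
    unfolding chamber_eq[OF generic_base]
    using c vert_max[OF generic_base self_in_chamber] by (auto simp: normal_cone_def inner_add_left)
  then have nonneg: "0 \<le> \<alpha> H \<bullet> c\<^sub>0 + t * (\<alpha> H \<bullet> c)" if "H \<in> \<A>" for H t
    using that by (fastforce simp: chamber_base inner_add_right)
  have "\<alpha> H \<bullet> c = 0" if H: "H \<in> \<A>" for H
  proof (rule ccontr)
    assume "\<alpha> H \<bullet> c \<noteq> 0"
    then show False
      \<comment> \<open>At this parameter the affine function takes the value
        \<open>- (\<alpha> H \<bullet> c\<^sub>0)\<close>.\<close>
      using nonneg[OF H, of "- 2 * (\<alpha> H \<bullet> c\<^sub>0) / (\<alpha> H \<bullet> c)"] normal_pos[OF H] by simp
  qed
  then show "c \<in> lineal \<A>" by (simp add: lineal_eq)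
qed

text \<open>By \<open>lineal_constant\<close>, \<open>lineal \<A>\<close> is the orthogonal
  complement of the direction space of \<open>P\<close>.\<close>

lemma aff_dim_polytope: "aff_dim P = int (dim ((lineal \<A>)\<^sup>\<bottom>))"
proof -
  let ?D = "(\<lambda>x. x - vert c\<^sub>0) ` P"
  have "lineal \<A> = (span ?D)\<^sup>\<bottom>"
    by (auto simp: lineal_constant orthogonal_comp_span inner_diff_right inner_commute)
  then have "(lineal \<A>)\<^sup>\<bottom> = span ?D" by (simp add: orthogonal_comp_self)
  moreover have "vert c\<^sub>0 \<in> affine hull P" by (intro hull_inc vert_in generic_base)
  ultimately show ?thesis by (simp add: aff_dim_eq_dim_subtract)
qed

text \<open>Moving \<open>p\<close> both ways inside \<open>K\<close> stays in the chamber, so every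
  functional in \<open>K\<close> is constant on the face maximising \<open>p\<close>, which
  therefore lies on a line in direction \<open>\<alpha> K\<close>. The vertex across the wall
  supplies its second point.\<close>

lemma wall_edge:
  assumes wall: "wall_point K p"
  defines "E \<equiv> P \<inter> {x. p \<bullet> x = p \<bullet> vert c\<^sub>0}"
  shows "E edge_of P" "vert c\<^sub>0 \<in> E" "\<exists>l>0. vert c\<^sub>0 - l *\<^sub>R \<alpha> K \<in> E"
proof -
  define v where "v = vert c\<^sub>0"
  have K: "K \<in> \<A>" "\<alpha> K \<bullet> p = 0" and p: "\<And>H. H \<in> \<A> - {K} \<Longrightarrow> 0 < \<alpha> H \<bullet> p"
    using wall by (auto simp: wall_point_def)
  note max0 = vert_max[OF generic_base, folded v_def]
  have vP: "v \<in> P" using vert_in[OF generic_base] by (simp add: v_def)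
  then show vE: "vert c\<^sub>0 \<in> E" by (simp add: E_def v_def)
  obtain d where d: "\<And>H. H \<in> \<A> - {K} \<Longrightarrow> 0 < \<alpha> H \<bullet> d" "\<alpha> K \<bullet> d < 0"
    using wall_neighbour[OF wall] by blast
  have gd: "generic d" using d by (fastforce simp: generic_def)
  have "\<exists>l>0. vert c\<^sub>0 - vert d = l *\<^sub>R \<alpha> K"
    by (rule wall_crossing(1)[OF K]) (use d p normal_pos K in auto)
  then obtain l where l: "l > 0" "v - vert d = l *\<^sub>R \<alpha> K" by (auto simp: v_def)
  define w where "w = v - l *\<^sub>R \<alpha> K"
  have w: "w = vert d" using l(2) by (simp add: w_def algebra_simps)
  have wE: "w \<in> E"
    using vert_in[OF gd] K by (simp add: E_def w[symmetric]) (simp add: w_def v_def inner_diff_right inner_commute)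
  then show "\<exists>l>0. vert c\<^sub>0 - l *\<^sub>R \<alpha> K \<in> E" using l(1) by (auto simp: w_def v_def)
  have face: "E face_of P"
    unfolding E_def using polytope_imp_convex[OF polytope] vert_max[OF generic_base wall_point_in_chamber[OF wall]]
    by (intro face_of_Int_supporting_hyperplane_le) auto
  have "x \<in> affine hull {v, w}" if x: "x \<in> E" for x
  proof -
    have "(x - v) \<bullet> h = 0" if h: "\<alpha> K \<bullet> h = 0" for h
    proof -
      obtain e where e: "0 < e"
        "\<And>H t. H \<in> \<A> - {K} \<Longrightarrow> \<bar>t\<bar> \<le> e \<Longrightarrow> 0 < \<alpha> H \<bullet> p + t * (\<alpha> H \<bullet> h)"
        using positive_perturbation[of "\<A> - {K}" "\<lambda>H. \<alpha> H \<bullet> p" "\<lambda>H. \<alpha> H \<bullet> h"]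
          finite_arrangement p by blast
      have "0 \<le> \<alpha> H \<bullet> (p + t *\<^sub>R h)" if "H \<in> \<A>" "\<bar>t\<bar> \<le> e" for H t
        using e(2)[of H t] that K h by (cases "H = K") (auto simp: inner_add_right less_imp_le)
      then have "p + t *\<^sub>R h \<in> chamber c\<^sub>0" if "\<bar>t\<bar> \<le> e" for t
        using that by (simp add: chamber_base)
      then have le: "t * (h \<bullet> x) \<le> t * (h \<bullet> v)" if "\<bar>t\<bar> \<le> e" for t
        using max0[of "p + t *\<^sub>R h" x] x that by (simp add: E_def v_def inner_add_left)
      have "e * (h \<bullet> x) = e * (h \<bullet> v)" using le[of e] le[of "-e"] e(1) by simp
      then show ?thesis using e(1) by (simp add: inner_diff_right inner_commute[of _ h])
    qed
    then obtain k where "x - v = k *\<^sub>R \<alpha> K" using multiple_of_normal[of "\<alpha> K" "x - v"] by blast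
    then have "x = v + (- k / l) *\<^sub>R (w - v)" using l(1) by (simp add: w_def algebra_simps)
    then show ?thesis unfolding affine_hull_2_alt by blast
  qed
  then have "aff_dim E \<le> aff_dim {v, w}" 
    by (metis aff_dim_affine_hull aff_dim_subset subsetI)
  moreover have "aff_dim {v, w} \<le> aff_dim E" using vE wE by (intro aff_dim_subset) (auto simp: v_def)
  moreover have "v \<noteq> w" using l(1) normal_nonzero[OF K(1)] by (auto simp: w_def)
  ultimately have "aff_dim E = 1" by (simp add: aff_dim_2)
  then show "E edge_of P" using face by (simp add: edge_of_def)
qed

lemma edges_at_vertex: "int (card {e. e edge_of P \<and> vert c\<^sub>0 \<in> e}) = aff_dim P"
proof -
  define v where "v = vert c\<^sub>0"
  obtain \<I> where I: "\<I> \<subseteq> \<A>" "\<And>H. H \<in> \<I> \<Longrightarrow> \<exists>p. wall_point H p"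
    "\<And>x. (\<And>H. H \<in> \<I> \<Longrightarrow> 0 \<le> \<alpha> H \<bullet> x) \<Longrightarrow> x \<in> chamber c\<^sub>0"
    using irredundant_walls by blast
  obtain p where p: "\<And>H. H \<in> \<I> \<Longrightarrow> wall_point H (p H)" using I(2) by metis
  define E where "E H = P \<inter> {x. p H \<bullet> x = p H \<bullet> v}" for H
  have E: "E H edge_of P" "v \<in> E H" "\<exists>l>0. v - l *\<^sub>R \<alpha> H \<in> E H" if "H \<in> \<I>" for H
    using wall_edge[OF p[OF that]] by (auto simp: E_def v_def)
  have inj: "inj_on E \<I>"
  proof (rule inj_onI, rule ccontr)
    fix H K assume HK: "H \<in> \<I>" "K \<in> \<I>" "E H = E K" "H \<noteq> K"
    then obtain l where "l > 0" "v - l *\<^sub>R \<alpha> H \<in> E K" using E(3) by metis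
    \<comment> \<open>Equal edges share their direction, so \<open>p K\<close> would also lie on
      \<open>H\<close>, although a wall point lies on one hyperplane only.\<close>
    then have "\<alpha> H \<bullet> p K = 0" by (simp add: E_def inner_diff_right inner_commute)
    moreover have "H \<in> \<A> - {K}" using HK I(1) by auto
    ultimately show False using p[OF HK(2)] unfolding wall_point_def by force
  qed
  have "\<exists>H\<in>\<I>. e = E H" if e: "e edge_of P" "v \<in> e" for e
  proof -
    have eface: "e face_of P" and edim: "aff_dim e = 1" using e by (auto simp: edge_of_def)
    then have "e exposed_face_of P"
      by (simp add: exposed_face_of_polyhedron polytope_imp_polyhedron polytope)
    then obtain a b where ab: "P \<subseteq> {x. a \<bullet> x \<le> b}" "e = P \<inter> {x. a \<bullet> x = b}"
      unfolding exposed_face_of_def by blast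
    have "a \<in> chamber c\<^sub>0"
      unfolding chamber_eq[OF generic_base] using ab e(2) by (auto simp: normal_cone_def v_def)
    then have a_nonneg: "0 \<le> \<alpha> H \<bullet> a" if "H \<in> \<A>" for H using that by (simp add: chamber_base)
    \<comment> \<open>An exposing functional that is strictly positive on every wall normal could be
      tilted towards any point of \<open>e\<close>, and then \<open>e\<close> would shrink to
      \<open>v\<close>.\<close>
    have "\<exists>H\<in>\<I>. \<alpha> H \<bullet> a = 0"
    proof (rule ccontr)
      assume "\<not> ?thesis"
      then have a_pos: "0 < \<alpha> H \<bullet> a" if "H \<in> \<I>" for H
        using a_nonneg[of H] I(1) that by (auto simp: order_less_le)
      have "x = v" if x: "x \<in> e" for x
      proof -
        define d where "d = x - v"
        obtain t where t: "0 < t"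
          "\<And>H s. H \<in> \<I> \<Longrightarrow> \<bar>s\<bar> \<le> t \<Longrightarrow> 0 < \<alpha> H \<bullet> a + s * (\<alpha> H \<bullet> d)"
          using positive_perturbation[of \<I> "\<lambda>H. \<alpha> H \<bullet> a" "\<lambda>H. \<alpha> H \<bullet> d"] a_pos
            finite_subset[OF I(1) finite_arrangement] by blast
        have "a + t *\<^sub>R d \<in> chamber c\<^sub>0"
          using t(1) t(2)[of _ t] by (intro I(3)) (simp add: inner_add_right less_imp_le)
        then have "(a + t *\<^sub>R d) \<bullet> x \<le> (a + t *\<^sub>R d) \<bullet> v"
          using vert_max[OF generic_base, of "a + t *\<^sub>R d" x] x ab(2) by (simp add: v_def)
        then have "t * (d \<bullet> d) \<le> 0"
          using x e(2) ab(2) by (simp add: d_def inner_add_left inner_diff_right algebra_simps)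
        then have "d \<bullet> d \<le> 0" using t(1) by (simp add: mult_le_0_iff)
        then have "d = 0" by (metis inner_eq_zero_iff inner_ge_zero order_antisym)
        then show ?thesis by (simp add: d_def)
      qed
      then have "e = {v}" using e(2) by blast
      then show False using edim by simp
    qed
    then obtain H where H: "H \<in> \<I>" "\<alpha> H \<bullet> a = 0" by blast
    obtain l where l: "l > 0" "v - l *\<^sub>R \<alpha> H \<in> E H" using E(3)[OF H(1)] by blast
    define w where "w = v - l *\<^sub>R \<alpha> H"
    have "a \<bullet> w = a \<bullet> v" using H(2) by (simp add: w_def inner_diff_right inner_commute)
    then have we: "w \<in> e" using l(2) e(2) ab(2) by (simp add: E_def w_def)
    have "v \<noteq> w" using l(1) normal_nonzero[of H] H(1) I(1) by (auto simp: w_def)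
    then have "aff_dim {v, w} = 1" by (simp add: aff_dim_2)
    \<comment> \<open>A face is recovered from its affine hull by intersecting with
      \<open>P\<close>; two edges sharing \<open>v\<close> and \<open>w\<close> span the same line
      and so agree.\<close>
    then have hull: "affine hull {v, w} = affine hull F" if "F edge_of P" "v \<in> F" "w \<in> F" for F
      using aff_dim_eq_full_gen[of "{v, w}" F] that by (simp add: edge_of_def)
    have "affine hull e = affine hull (E H)"
      using hull[OF e we] hull[OF E(1,2)[OF H(1)]] l(2) by (simp add: w_def)
    then have "e = E H"
      using face_of_imp_eq_affine_Int[OF polytope_imp_convex[OF polytope]] eface E(1)[OF H(1)]
      by (metis edge_of_def)
    then show ?thesis using H(1) by blast
  qed
  then have "{e. e edge_of P \<and> vert c\<^sub>0 \<in> e} = E ` \<I>" using E(1,2) by (auto simp: v_def)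
  then have "card {e. e edge_of P \<and> vert c\<^sub>0 \<in> e} = card \<I>" by (simp add: card_image inj)
  also have "card \<I> = card (\<alpha> ` \<I>)"
    using wall_normals_independent(2)[OF I(1,2)] by (simp add: card_image)
  also have "\<dots> = dim (span (\<alpha> ` \<I>))"
    using dim_eq_card_independent[OF wall_normals_independent(1)[OF I(1,2)]] by simp
  also have "\<dots> = dim ((lineal \<A>)\<^sup>\<bottom>)" by (simp add: span_normals[OF I(1,3)])
  finally show ?thesis by (simp add: aff_dim_polytope)
qed

end

section \<open>From chambers to arrangements and polytopes\<close>

lemma inscribed_chamber_exists:
  assumes "hyperplane_arrangement \<A>" "inscribed P" "normal_fan P = arrangement_fan \<A>" "c \<notin> \<Union>\<A>"
  obtains \<alpha> z r where "inscribed_chamber \<A> \<alpha> c P z r"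
proof -
  obtain z r where zr: "polytope P" "\<And>v. v extreme_point_of P \<Longrightarrow> v \<in> sphere z r"
    using assms(2) by (auto simp: inscribed_def)
  obtain \<alpha> where "arrangement_chamber \<A> \<alpha> c" using arrangement_chamber_exists assms by blast
  then have "inscribed_chamber \<A> \<alpha> c P z r"
    unfolding inscribed_chamber_def inscribed_chamber_axioms_def using zr assms(3) by blast
  then show ?thesis by (rule that)
qed

lemma inscribable_imp_simplicial:
  assumes arr: "hyperplane_arrangement \<A>" and "inscribable \<A>"
  shows "simplicial_arrangement \<A>"
  unfolding simplicial_arrangement_def
proof
  obtain P where P: "inscribed P" "normal_fan P = arrangement_fan \<A>"
    using assms(2) by (auto simp: inscribable_def)
  let ?V = "(lineal \<A>)\<^sup>\<bottom>"
  fix R assume "R \<in> regions ?V (essentialization \<A>)"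
  then obtain K where K: "K \<in> components (?V - \<Union>(essentialization \<A>))" "R = closure K"
    by (auto simp: regions_def)
  \<comment> \<open>Inside \<open>?V\<close> the essentialized hyperplanes remove the same points as
    the original ones, so signs can be read off from the normals of \<open>\<A>\<close>.\<close>
  moreover have "?V - \<Union>(essentialization \<A>) = ?V - \<Union>\<A>" by (auto simp: essentialization_def)
  ultimately obtain c where c: "c \<in> ?V" "c \<notin> \<Union>\<A>" "R = closure (connected_component_set (?V - \<Union>\<A>) c)"
    by (auto simp: components_def)
  obtain \<alpha> z r where "inscribed_chamber \<A> \<alpha> c P z r"
    using inscribed_chamber_exists[OF arr P c(2)] by blast
  then interpret inscribed_chamber \<A> \<alpha> c P z r .
  have "R = {x \<in> ?V. \<forall>H\<in>\<A>. 0 \<le> (\<alpha> H \<bullet> c) * (\<alpha> H \<bullet> x)}"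
    unfolding c(3) by (rule closure_component_arrangement[OF subspace_orthogonal_comp hyperplane_eq c(1,2)])
  also have "\<dots> = ?V \<inter> chamber c" by (auto simp: chamber_def)
  finally show "simplicial_cone R" using simplicial_cone_chamber by simp
qed

text \<open>The edge count is known at vertices of the form \<open>vert c\<close>. An arbitrary
  vertex has this form because its exposing functional can be moved off all hyperplanes without
  losing \<open>v\<close> as strict maximiser.\<close>

lemma inscribed_belt_imp_simple:
  assumes "belt_polytope P" and ins: "inscribed P"
  shows "simple_polytope P"
  unfolding simple_polytope_def
proof (intro conjI allI impI)
  show P: "polytope P" using assms(1) by (simp add: belt_polytope_def)
  obtain \<A> where arr: "hyperplane_arrangement \<A>" and fan: "normal_fan P = arrangement_fan \<A>"
    using assms(1) by (auto simp: belt_polytope_def)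
  obtain V where V: "finite V" "P = convex hull V" using P by (auto simp: polytope_def)
  fix v assume v: "v extreme_point_of P"
  then have "{v} exposed_face_of P"
    by (simp add: exposed_face_of_polyhedron polytope_imp_polyhedron P face_of_singleton)
  then obtain a b where ab: "P \<subseteq> {x. a \<bullet> x \<le> b}" "{v} = P \<inter> {x. a \<bullet> x = b}"
    unfolding exposed_face_of_def by blast
  \<comment> \<open>Strict maximality at \<open>v\<close> is imposed only against the finite
    generating set, which makes it an open condition on the functional.\<close>
  define U where "U = (\<Inter>x\<in>V - {v}. {c. (x - v) \<bullet> c < 0})"
  have "open U" unfolding U_def using V(1)
    by (intro open_INT) (auto simp only: finite_Diff open_halfspace_lt)
  moreover have "a \<in> U"
    unfolding U_def
  proof
    fix x assume x: "x \<in> V - {v}"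
    then have "x \<in> P" using V(2) by (auto intro: hull_inc)
    then have "a \<bullet> x < b" using x ab by (auto simp: order_less_le)
    moreover have "a \<bullet> v = b" using ab(2) by blast
    ultimately show "a \<in> {c. (x - v) \<bullet> c < 0}" by (simp add: inner_diff_right inner_commute)
  qed
  ultimately obtain c where c: "c \<in> U" "c \<notin> \<Union>\<A>"
    using generic_point_exists[OF arr, of U] by blast
  obtain \<alpha> z r where "inscribed_chamber \<A> \<alpha> c P z r"
    using inscribed_chamber_exists[OF arr ins fan c(2)] by blast
  then interpret inscribed_chamber \<A> \<alpha> c P z r .
  have "vert c \<in> V"
    using vert_extreme[OF generic_base] V(2) extreme_points_of_convex_hull by blast
  moreover have "c \<bullet> v \<le> c \<bullet> vert c"
    using vert_max[OF generic_base self_in_chamber] v by (simp add: extreme_point_of_def)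
  moreover have "c \<bullet> x < c \<bullet> v" if "x \<in> V - {v}" for x
    using c(1) that by (auto simp: U_def inner_diff_left inner_commute[of c])
  ultimately have "vert c = v" by (metis DiffI not_less singletonD)
  then show "int (card {e. e edge_of P \<and> v \<in> e}) = aff_dim P" using edges_at_vertex by simp
qed

theorem theorem1p4:
  shows "(\<forall>\<A> :: 'a::euclidean_space set set.
            hyperplane_arrangement \<A> \<and> inscribable \<A> \<longrightarrow> simplicial_arrangement \<A>) \<and>
         (\<forall>P :: 'a set. belt_polytope P \<and> inscribed P \<longrightarrow> simple_polytope P)"
  using inscribable_imp_simplicial inscribed_belt_imp_simple by blast

end
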